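(* Let $(X,d)$ be a metric space and let $f_n:X\to X$, $n\ge 0$, be a sequence of maps, defining the non-autonomous discrete system $x_{n+1}=f_n(x_n)$, $n\ge0$. Assume that there exists an increasing sequence $\{k_n\}_{n=1}^\infty$ of positive integers such that the induced maps $$\hat f_0:=f_{k_1-1}\circ f_{k_1-2}\circ\cdots\circ f_0,\qquad \hat f_n:=f_{k_{n+1}-1}\circ f_{k_{n+1}-2}\circ\cdots\circ f_{k_n}\ (n\ge1)$$ satisfy the following. There are $N\ge2$, an irreducible transition matrix $A=(a_{ij})_{N\times N}$ with $\sum_{j=1}^N a_{i_0j}\ge2$ for some $1\le i_0\le N$, pairwise disjoint nonempty compact subsets $V_1,\dots,V_N$ of $X$ such that $\hat f_n$ is continuous in $\bigcup_{i=1}^N V_i$ for every $n\ge0$, and, for each $1\le i\le N$, a sequence $\{V_{i,n}\}_{n=0}^\infty$ of nonempty closed subsets of $V_i$, such that, with $$V_\alpha^{m,n}:=\bigcap_{k=0}^{m}\hat f_n^{-k}(V_{a_k,n+k}),\qquad \alpha=(a_0,a_1,\dots)\in\Sigma_N^+(A),\ m,n\ge0,$$ (i) $V_\alpha^{m,n}\ne\emptyset$ for all $m,n\ge0$ and all $\alpha\in\Sigma_N^+(A)$; (ii) there exist $\beta=(b_0,b_1,\dots)\in\Sigma_N^+(A)$, an increasing sequence $\{m_k\}_{k=1}^\infty$ of positive integers, and $1\le s_0\le N$ such that $b_{m_k}=s_0$ for all $k\ge1$, and such that for every increasing sequence $\{n_k\}_{k=1}^\infty$ of nonnegative integers, the diameter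 $d(V_\beta^{m_k,n_k})$ converges to $0$ as $k\to\infty$. Then the system $x_{n+1}=f_n(x_n)$, $n\ge0$, is Li-Yorke $\delta$-chaotic for some $\delta>0$. Further, if $X$ is bounded, then the system $x_{n+1}=f_n(x_n)$, $n\ge0$, is chaotic in the strong sense of Li-Yorke.
   Context: Notation: for $n\ge1$, $f_0^n:=f_{n-1}\circ\cdots\circ f_0$, and $f_0^0$ is the identity. Similarly, for $i\ge0$, $n\ge1$, $\hat f_i^n:=\hat f_{i+n-1}\circ\cdots\circ \hat f_i$, $\hat f_i^0$ is the identity, and $\hat f_i^{-n}(B)=\{x\in X:\hat f_i^n(x)\in B\}$. For a nonempty set $B\subset X$, $d(B):=\sup\{d(x,y):x,y\in B\}$ is its diameter. "Increasing" means strictly increasing. "Continuous in $\bigcup_i V_i$" means that the restriction to this set is continuous. A matrix $A=(a_{ij})_{N\times N}$ ($N\ge2$) is a transition matrix if $a_{ij}\in\{0,1\}$ for all $i,j$, $\sum_{j}a_{ij}\ge1$ for all $i$, and $\sum_i a_{ij}\ge1$ for all $j$. It is irreducible if for each pair $1\le i,j\le N$ there is a positive integer $k$ such that the $(i,j)$ entry of $A^k$ is positive. $\Sigma_N^+(A):=\{(s_0,s_1,\dots): 1\le s_j\le N,\ a_{s_js_{j+1}}=1,\ j\ge0\}$. The system $x_{n+1}=f_n(x_n)$ is Li-Yorke $\delta$-chaotic ($\delta>0$) if there is an uncountable set $S\subset X$ such that for all distinct $x,y\in S$, $\liminf_{n\to\infty}d(f_0^n(x),f_0^n(y))=0$ and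 $\limsup_{n\to\infty}d(f_0^n(x),f_0^n(y))>\delta$. It is chaotic in the strong sense of Li-Yorke if, for some $\delta>0$, there is such a set $S$ for which, in addition, every orbit $\{f_0^n(x)\}_{n\ge0}$, $x\in S$, is bounded. *)

theory Defs
  imports
    "HOL-Analysis.Elementary_Metric_Spaces"
    "HOL-Library.Extended_Real"
    "HOL-Library.Disjoint_Sets"
    "Jordan_Normal_Form.Matrix"
begin

(* ncomp g i n = g (i+n-1) o ... o g i is the n-step evolution started at time i;
   ncomp f 0 n is the map written f_0^n in the theory of non-autonomous systems. *)
primrec ncomp :: "(nat \<Rightarrow> 'a \<Rightarrow> 'a) \<Rightarrow> nat \<Rightarrow> nat \<Rightarrow> 'a \<Rightarrow> 'a" where
  "ncomp g i 0 = id"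
| "ncomp g i (Suc n) = g (i + n) \<circ> ncomp g i n"

(* The sequence k is indexed from 1; the value k 0 is never used. *)
definition induced :: "(nat \<Rightarrow> 'a \<Rightarrow> 'a) \<Rightarrow> (nat \<Rightarrow> nat) \<Rightarrow> nat \<Rightarrow> 'a \<Rightarrow> 'a" where
  "induced f k n =
     (if n = 0 then ncomp f 0 (k 1) else ncomp f (k n) (k (n + 1) - k n))"

(* Matrices of the library are indexed from 0, so the symbols are 0, ..., N-1
   instead of 1, ..., N. *)
definition transition_matrix :: "nat \<Rightarrow> nat mat \<Rightarrow> bool" where
  "transition_matrix N A \<longleftrightarrow>
     N \<ge> 2 \<and> A \<in> carrier_mat N N \<and>
     (\<forall>i<N. \<forall>j<N. A $$ (i, j) \<in> {0, 1}) \<and>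
     (\<forall>i<N. (\<Sum>j<N. A $$ (i, j)) \<ge> 1) \<and>
     (\<forall>j<N. (\<Sum>i<N. A $$ (i, j)) \<ge> 1)"

definition irreducible_matrix :: "nat \<Rightarrow> nat mat \<Rightarrow> bool" where
  "irreducible_matrix N A \<longleftrightarrow>
     (\<forall>i<N. \<forall>j<N. \<exists>k>0. (A ^\<^sub>m k) $$ (i, j) > 0)"

definition subshift :: "nat \<Rightarrow> nat mat \<Rightarrow> (nat \<Rightarrow> nat) set" where
  "subshift N A = {s. \<forall>j. s j < N \<and> A $$ (s j, s (Suc j)) = 1}"

(* The set V_alpha^{m,n} of points that, started at time n, follow the itinerary alpha
   through the sets W i n for m steps. *)
definition itinerary_set ::
  "(nat \<Rightarrow> 'a \<Rightarrow> 'a) \<Rightarrow> (nat \<Rightarrow> nat \<Rightarrow> 'a set) \<Rightarrow> (nat \<Rightarrow> nat) \<Rightarrow> nat \<Rightarrow> nat \<Rightarrow> 'a set" where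
  "itinerary_set g W \<alpha> m n = (\<Inter>k\<in>{0..m}. ncomp g n k -` W (\<alpha> k) (n + k))"

(* Lower and upper limits are taken in ereal, as the upper limit may be infinite. *)
definition scrambled_set ::
  "(nat \<Rightarrow> 'a::metric_space \<Rightarrow> 'a) \<Rightarrow> real \<Rightarrow> 'a set \<Rightarrow> bool" where
  "scrambled_set f \<delta> S \<longleftrightarrow>
     (\<forall>x\<in>S. \<forall>y\<in>S. x \<noteq> y \<longrightarrow>
        liminf (\<lambda>n. ereal (dist (ncomp f 0 n x) (ncomp f 0 n y))) = 0 \<and>
        limsup (\<lambda>n. ereal (dist (ncomp f 0 n x) (ncomp f 0 n y))) > ereal \<delta>)"

definition li_yorke_chaotic :: "(nat \<Rightarrow> 'a::metric_space \<Rightarrow> 'a) \<Rightarrow> real \<Rightarrow> bool" where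
  "li_yorke_chaotic f \<delta> \<longleftrightarrow>
     \<delta> > 0 \<and> (\<exists>S. uncountable S \<and> scrambled_set f \<delta> S)"

definition strongly_li_yorke_chaotic :: "(nat \<Rightarrow> 'a::metric_space \<Rightarrow> 'a) \<Rightarrow> bool" where
  "strongly_li_yorke_chaotic f \<longleftrightarrow>
     (\<exists>\<delta>>0. \<exists>S. uncountable S \<and> scrambled_set f \<delta> S \<and>
        (\<forall>x\<in>S. bounded (range (\<lambda>n. ncomp f 0 n x))))"

end

theory Submission
  imports Defs
begin

text \<open>Let \<open>w\<^sub>0 \<noteq> w\<^sub>1\<close> be two paths of equal length from \<open>s\<^sub>0\<close> to \<open>b\<^sub>0\<close>; they exist by
  irreducibility and the branching at \<open>i\<^sub>0\<close>. To a bit sequence \<open>d\<close> we associate the itinerary that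
  runs through \<open>b\<^sub>0 \<dots> b\<^bsub>m\<^sub>l\<^esub>\<close> followed by the path selected by a bit of \<open>d\<close>, for
  \<open>l = 1, 2, \<dots>\<close>, each bit being used infinitely often. A point following it exists by
  compactness. At the beginning of the blocks any two such points lie in common sets
  \<open>V\<^bsub>\<beta>\<^esub>\<close> of diameters tending to 0, while infinitely often they lie in different sets \<open>V\<^sub>i\<close>.\<close>

section \<open>Composition of non-autonomous maps\<close>

lemma ncomp_shift: "ncomp g (i + m) n (ncomp g i m x) = ncomp g i (m + n) x"
  by (induction n) (simp_all add: add.assoc)

text \<open>The composed blocks telescope, so orbits of the induced system are orbits of
  \<open>f\<close> observed at the times \<open>k n\<close>. The index \<open>Suc n\<close> avoids
  the meaningless value \<open>k 0\<close>.\<close>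

lemma ncomp_induced:
  assumes "strict_mono_on {1..} k"
  shows "ncomp (induced f k) 0 (Suc n) = ncomp f 0 (k (Suc n))"
proof (induction n)
  case 0
  show ?case by (simp add: induced_def)
next
  case (Suc n)
  have "k (Suc n) < k (Suc (Suc n))"
    using assms by (auto simp: strict_mono_on_def)
  then show ?case
    using Suc.IH ncomp_shift[of f 0 "k (Suc n)" "k (Suc (Suc n)) - k (Suc n)"]
    by (auto simp: induced_def fun_eq_iff)
qed

section \<open>Points following an infinite itinerary\<close>

lemma mem_itinerary_set_iff:
  "x \<in> itinerary_set g W \<alpha> m n \<longleftrightarrow> (\<forall>k\<le>m. ncomp g n k x \<in> W (\<alpha> k) (n + k))"
  by (auto simp: itinerary_set_def)

lemma itinerary_set_Suc:
  "itinerary_set g W \<alpha> (Suc m) n =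
     itinerary_set g W \<alpha> m n \<inter> ncomp g n (Suc m) -` W (\<alpha> (Suc m)) (n + Suc m)"
  unfolding itinerary_set_def by (simp del: ncomp.simps add: atLeast0_atMost_Suc Int_commute)

lemma itinerary_set_antimono:
  "m \<le> m' \<Longrightarrow> itinerary_set g W \<alpha> m' n \<subseteq> itinerary_set g W \<alpha> m n"
  by (auto simp: mem_itinerary_set_iff)

text \<open>Each \<open>g n\<close> is continuous only on \<open>U\<close>, so both claims go
  through one induction: the itinerary keeps the \<open>m\<close>-step image inside
  \<open>U\<close>, which makes the next iterate continuous on the old compact set, and the new
  condition then cuts out a closed subset of it.\<close>

lemma compact_itinerary_set:
  fixes g :: "nat \<Rightarrow> 'a::t2_space \<Rightarrow> 'a"
  assumes g: "\<And>n. continuous_on U (g n)"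
    and W: "\<And>j n. compact (W (\<alpha> j) n)" "\<And>j n. W (\<alpha> j) n \<subseteq> U"
  shows "compact (itinerary_set g W \<alpha> m n) \<and>
    continuous_on (itinerary_set g W \<alpha> m n) (ncomp g n m)"
proof (induction m)
  case 0
  show ?case using W by (simp add: itinerary_set_def id_def)
next
  case (Suc m)
  let ?I = "itinerary_set g W \<alpha> m n"
  have "ncomp g n m ` ?I \<subseteq> U"
    using W(2) by (fastforce simp: mem_itinerary_set_iff)
  then have cont: "continuous_on ?I (ncomp g n (Suc m))"
    unfolding ncomp.simps using Suc.IH g
    by (intro continuous_on_compose) (auto intro: continuous_on_subset)
  then have "closed (ncomp g n (Suc m) -` W (\<alpha> (Suc m)) (n + Suc m) \<inter> ?I)"
    using Suc.IH W(1) by (intro closed_vimage_Int) (auto simp: compact_imp_closed)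
  then have "compact (?I \<inter> (ncomp g n (Suc m) -` W (\<alpha> (Suc m)) (n + Suc m) \<inter> ?I))"
    using Suc.IH by (intro compact_Int_closed) auto
  then have "compact (itinerary_set g W \<alpha> (Suc m) n)"
    unfolding itinerary_set_Suc by (simp del: ncomp.simps add: Int_ac)
  then show ?case
    using cont itinerary_set_antimono[of m "Suc m"]
    by (meson continuous_on_subset le_SucI order_refl)
qed

text \<open>The itinerary sets for growing \<open>m\<close> are nested, nonempty and compact, so by
  the finite intersection property they share a point.\<close>

lemma ex_infinite_itinerary:
  fixes g :: "nat \<Rightarrow> 'a::t2_space \<Rightarrow> 'a"
  assumes "\<And>n. continuous_on U (g n)"
    and "\<And>j n. compact (W (\<alpha> j) n)" "\<And>j n. W (\<alpha> j) n \<subseteq> U"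
    and ne: "\<And>m. itinerary_set g W \<alpha> m 0 \<noteq> {}"
  shows "\<exists>x. \<forall>j. ncomp g 0 j x \<in> W (\<alpha> j) j"
proof -
  let ?I = "\<lambda>m. itinerary_set g W \<alpha> m 0"
  have cpt: "compact (?I m)" for m
    using compact_itinerary_set[of U g W \<alpha>] assms by blast
  have "?I 0 \<inter> (\<Inter>m\<in>UNIV. ?I m) \<noteq> {}"
  proof (rule compact_imp_fip_image)
    fix J :: "nat set" assume "finite J"
    then obtain M where "\<forall>j\<in>J. j \<le> M"
      using finite_nat_set_iff_bounded_le by blast
    then have "?I M \<subseteq> ?I 0 \<inter> (\<Inter>m\<in>J. ?I m)"
      using itinerary_set_antimono by (metis INT_greatest Int_greatest le0)
    then show "?I 0 \<inter> (\<Inter>m\<in>J. ?I m) \<noteq> {}"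
      using ne[of M] by blast
  qed (auto simp: cpt compact_imp_closed)
  then obtain x where "\<forall>m. x \<in> ?I m" by blast
  then have "\<forall>m. ncomp g 0 m x \<in> W (\<alpha> m) m"
    by (metis mem_itinerary_set_iff add_0 order_refl)
  then show ?thesis by blast
qed

text \<open>On one compact set, \<open>infdist\<close> to another one attains its minimum, which is
  positive by disjointness; finitely many pairs allow a common bound.\<close>

lemma finite_disjoint_compact_separated:
  fixes V :: "'i \<Rightarrow> 'a::metric_space set"
  assumes "finite I" and disj: "disjoint_family_on V I"
    and V: "\<And>i. i \<in> I \<Longrightarrow> V i \<noteq> {} \<and> compact (V i)"
  obtains \<epsilon> where "\<epsilon> > 0"
    "\<And>i j x y. \<lbrakk>i \<in> I; j \<in> I; i \<noteq> j; x \<in> V i; y \<in> V j\<rbrakk> \<Longrightarrow> \<epsilon> \<le> dist x y"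
proof -
  have "\<exists>e>0. \<forall>x\<in>V i. \<forall>y\<in>V j. e \<le> dist x y" if ij: "i \<in> I" "j \<in> I" "i \<noteq> j" for i j
  proof -
    have "continuous_on (V i) (\<lambda>x. infdist x (V j))"
      by (intro continuous_intros)
    then obtain z where z: "z \<in> V i" "\<forall>x\<in>V i. infdist z (V j) \<le> infdist x (V j)"
      using continuous_attains_inf[of "V i"] V[OF ij(1)] by blast
    then have "z \<notin> V j"
      using disj ij by (auto simp: disjoint_family_on_def)
    then have "infdist z (V j) > 0"
      using V[OF ij(2)] by (intro infdist_pos_not_in_closed) (auto simp: compact_imp_closed)
    with z show ?thesis
      by (meson infdist_le order_trans)
  qed
  then obtain e where e: "\<And>i j. \<lbrakk>i \<in> I; j \<in> I; i \<noteq> j\<rbrakk> \<Longrightarrow>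
      e i j > 0 \<and> (\<forall>x\<in>V i. \<forall>y\<in>V j. e i j \<le> dist x y)"
    by metis
  let ?P = "{(i, j). i \<in> I \<and> j \<in> I \<and> i \<noteq> j}"
  \<comment> \<open>The added 1 keeps the set nonempty when \<open>I\<close> has no two distinct
    elements.\<close>
  define \<epsilon> where "\<epsilon> = Min (insert 1 ((\<lambda>(i, j). e i j) ` ?P))"
  have "finite ?P"
    by (rule finite_subset[of _ "I \<times> I"]) (use \<open>finite I\<close> in auto)
  then have fin: "finite (insert (1::real) ((\<lambda>(i, j). e i j) ` ?P))" by simp
  show thesis
  proof
    show "\<epsilon> > 0"
      unfolding \<epsilon>_def using fin e by (subst Min_gr_iff) auto
    fix i j x y assume ij: "i \<in> I" "j \<in> I" "i \<noteq> j" and "x \<in> V i" "y \<in> V j"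
    have "\<epsilon> \<le> e i j"
      unfolding \<epsilon>_def using fin ij by (intro Min_le) auto
    also have "\<dots> \<le> dist x y"
      using e ij \<open>x \<in> V i\<close> \<open>y \<in> V j\<close> by blast
    finally show "\<epsilon> \<le> dist x y" .
  qed
qed

section \<open>Symbolic dynamics\<close>

text \<open>If all blocks are nonempty, the first \<open>Suc n\<close> of them contain more than
  \<open>n\<close> letters, so this is the infinite concatenation of \<open>B 0\<close>,
  \<open>B 1\<close>, and so on.\<close>

definition concat_blocks :: "(nat \<Rightarrow> 'a list) \<Rightarrow> nat \<Rightarrow> 'a" where
  "concat_blocks B n = concat (map B [0..<Suc n]) ! n"

text \<open>Longer prefixes only append letters, so any prefix reaching position \<open>i\<close>
  can replace the one in the definition.\<close>

lemma concat_blocks_nth: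
  assumes B: "\<And>l. B l \<noteq> []" and i: "i < length (concat (map B [0..<l]))"
  shows "concat_blocks B i = concat (map B [0..<l]) ! i"
proof -
  have len: "l \<le> length (concat (map B [0..<l]))" for l
  proof (induction l)
    case (Suc l)
    have "0 < length (B l)" using B by simp
    with Suc show ?case by (simp del: length_greater_0_conv)
  qed simp
  have pre: "concat (map B [0..<l]) ! i = concat (map B [0..<l']) ! i"
    if "l \<le> l'" "i < length (concat (map B [0..<l]))" for l l'
  proof -
    have "[0..<l'] = [0..<l] @ [l..<l']"
      using that(1) upt_add_eq_append[of 0 l "l' - l"] by simp
    with that(2) show ?thesis by (simp add: nth_append)
  qed
  have "i < length (concat (map B [0..<Suc i]))"
    using len[of "Suc i"] by simp
  then show ?thesis
    unfolding concat_blocks_def using pre i by (metis nle_le)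
qed

lemma concat_blocks_block:
  assumes "\<And>l. B l \<noteq> []" and "i < length (B l)"
  shows "concat_blocks B (length (concat (map B [0..<l])) + i) = B l ! i"
  using assms concat_blocks_nth[of B "length (concat (map B [0..<l])) + i" "Suc l"]
  by (simp add: nth_append)

text \<open>Positions \<open>n\<close> and \<open>Suc n\<close> both lie within the first
  \<open>n + 2\<close> blocks, whose finite concatenation is a path because consecutive blocks are
  linked.\<close>

lemma concat_blocks_path:
  assumes B: "\<And>l. B l \<noteq> []" and path: "\<And>l. successively E (B l)"
    and link: "\<And>l. E (last (B l)) (hd (B (Suc l)))"
  shows "E (concat_blocks B n) (concat_blocks B (Suc n))"
proof -
  let ?p = "\<lambda>l. concat (map B [0..<l])"
  have p: "successively E (?p (Suc l)) \<and> ?p (Suc l) \<noteq> [] \<and> last (?p (Suc l)) = last (B l) \<and>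
      l < length (?p (Suc l))" for l
  proof (induction l)
    case 0
    show ?case using B path by simp
  next
    case (Suc l)
    have "0 < length (B (Suc l))" using B by simp
    moreover have "?p (Suc (Suc l)) = ?p (Suc l) @ B (Suc l)" by simp
    ultimately show ?case
      using Suc B path link
      by (simp del: upt_Suc length_greater_0_conv add: successively_append_iff)
  qed
  have lt: "Suc n < length (?p (Suc (Suc n)))" using p by blast
  then have "E (?p (Suc (Suc n)) ! n) (?p (Suc (Suc n)) ! Suc n)"
    using p[of "Suc n"] by (simp del: upt_Suc add: successively_conv_nth)
  then show ?thesis
    using concat_blocks_nth[OF B Suc_lessD[OF lt]] concat_blocks_nth[OF B lt] by simp
qed

text \<open>The block starts \<open>t l\<close> must be common to all codes \<open>d\<close>, since
  points with different codes are to be compared at the same times; this is why the two detours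
  \<open>R b\<close> have equal length.\<close>

lemma ex_uncountable_coding:
  fixes E :: "'s \<Rightarrow> 's \<Rightarrow> bool"
  assumes \<beta>: "\<And>n. E (\<beta> n) (\<beta> (Suc n))" and m: "\<And>l. \<beta> (m l) = s"
    and R: "length (R True) = length (R False)" "R True \<noteq> R False"
      "\<And>b. successively E (s # R b @ [\<beta> 0])"
  obtains \<alpha> :: "(nat \<Rightarrow> bool) \<Rightarrow> nat \<Rightarrow> 's" and t :: "nat \<Rightarrow> nat"
  where "strict_mono t" "\<And>d n. E (\<alpha> d n) (\<alpha> d (Suc n))"
    "\<And>d l i. i \<le> m l \<Longrightarrow> \<alpha> d (t l + i) = \<beta> i"
    "\<And>d d'. d \<noteq> d' \<Longrightarrow> \<exists>\<^sub>\<infinity>n. \<alpha> d n \<noteq> \<alpha> d' n"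
proof -
  define block where "block l b = map \<beta> [0..<Suc (m l)] @ R b" for l b
  \<comment> \<open>Every bit of \<open>d\<close> is used in infinitely many blocks, so that distinct codes
    differ infinitely often.\<close>
  define blocks where "blocks d l = block l (d (fst (prod_decode l)))" for d l
  define t where "t l = length (concat (map (\<lambda>l. block l True) [0..<l]))" for l
  define \<alpha> where "\<alpha> d = concat_blocks (blocks d)" for d
  have len: "length (block l b) = Suc (m l) + length (R True)" for l b
    using R(1) by (cases b) (auto simp: block_def)
  have ne: "blocks d l \<noteq> []" for d l
    using len unfolding blocks_def by (metis add_Suc list.size(3) nat.distinct(1))
  have t: "length (concat (map (blocks d) [0..<l])) = t l" for d l
    unfolding t_def blocks_def by (induction l) (simp_all add: len)
  have \<alpha>_block: "\<alpha> d (t l + i) = blocks d l ! i" if "i < Suc (m l) + length (R True)" for d l i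
    using concat_blocks_block[of "blocks d" i l] ne that
    unfolding \<alpha>_def t by (simp add: blocks_def len)
  show thesis
  proof
    show "strict_mono t"
      by (simp add: strict_mono_Suc_iff t_def len)
    show "E (\<alpha> d n) (\<alpha> d (Suc n))" for d n
      unfolding \<alpha>_def
    proof (rule concat_blocks_path[OF ne])
      fix l
      have suc: "successively E (map \<beta> [0..<Suc (m l)])"
        by (simp del: upt_Suc add: successively_conv_nth \<beta>)
      have last: "last (map \<beta> [0..<Suc (m l)]) = s" by (simp add: m)
      \<comment> \<open>Every block begins with \<open>\<beta> 0\<close>, so appending this letter
        covers the edge to the next block as well.\<close>
      have "successively E (block l b @ [\<beta> 0])" for b
        using suc last R(3)[of b]
        by (simp del: upt_Suc add: block_def successively_append_iff[of E "map \<beta> [0..<Suc (m l)]"]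
            successively_Cons)
      then have *: "successively E (blocks d l @ [\<beta> 0])"
        unfolding blocks_def .
      then show "successively E (blocks d l)"
        by (simp add: successively_append_iff)
      have "hd (blocks d (Suc l)) = \<beta> 0"
        by (simp add: blocks_def block_def hd_append hd_map del: upt_Suc)
      with * ne show "E (last (blocks d l)) (hd (blocks d (Suc l)))"
        by (simp add: successively_append_iff)
    qed
    show "\<alpha> d (t l + i) = \<beta> i" if "i \<le> m l" for d l i
      using that \<alpha>_block[of i l d]
      by (simp del: upt_Suc add: blocks_def block_def nth_append)
    show "\<exists>\<^sub>\<infinity>n. \<alpha> d n \<noteq> \<alpha> d' n" if neq: "d \<noteq> d'" for d d'
    proof -
      obtain q where q: "d q \<noteq> d' q" using neq by blast
      obtain i where i: "i < length (R True)" "R True ! i \<noteq> R False ! i"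
        using R(1,2) nth_equalityI by metis
      have "\<exists>n\<ge>j. \<alpha> d n \<noteq> \<alpha> d' n" for j
      proof (intro exI conjI)
        \<comment> \<open>Block \<open>?l\<close> reads bit \<open>q\<close>, and the
          \<open>i\<close>-th letter of its detour comes \<open>Suc (m ?l) + i\<close> places after
          the block start. The choice of \<open>j\<close> pushes this position beyond
          \<open>j\<close>.\<close>
        let ?l = "prod_encode (q, j)"
        have "j \<le> ?l" by (rule le_prod_encode_2)
        also have "?l \<le> t ?l"
          using \<open>strict_mono t\<close> by (rule strict_mono_imp_increasing)
        finally show "j \<le> t ?l + (Suc (m ?l) + i)" by simp
        have "R (d q) ! i \<noteq> R (d' q) ! i"
          using q i(2) by (cases "d q"; cases "d' q") auto
        then show "\<alpha> d (t ?l + (Suc (m ?l) + i)) \<noteq> \<alpha> d' (t ?l + (Suc (m ?l) + i))"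
          using i(1) \<alpha>_block[of "Suc (m ?l) + i" ?l]
          by (simp del: upt_Suc add: blocks_def block_def nth_append)
      qed
      then show ?thesis by (simp add: INFM_nat_le)
    qed
  qed
qed

section \<open>Paths in the graph of an irreducible transition matrix\<close>

lemma tranclp_imp_path:
  "E\<^sup>+\<^sup>+ x y \<Longrightarrow> \<exists>p. successively E (x # p @ [y])"
proof (induction rule: tranclp_induct)
  case (base y)
  then have "successively E (x # [] @ [y])" by simp
  then show ?case by blast
next
  case (step y z)
  then obtain p where "successively E (x # p @ [y])" by blast
  with step.hyps(2) have "successively E ((x # p @ [y]) @ [z])"
    unfolding successively_append_iff by simp
  then have "successively E (x # (p @ [y]) @ [z])" by simp
  then show ?case by blast
qed

text \<open>The two loops through \<open>i\<close> starting with \<open>j\<^sub>1\<close> and \<open>j\<^sub>2\<close> may have different lengths;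
  traversing both, in either order, gives paths of equal length.\<close>

lemma ex_distinct_paths_equal_length:
  assumes conn: "E\<^sup>+\<^sup>+ s i" "E\<^sup>+\<^sup>+ j\<^sub>1 i" "E\<^sup>+\<^sup>+ j\<^sub>2 i" "E\<^sup>+\<^sup>+ i b"
    and branch: "E i j\<^sub>1" "E i j\<^sub>2" "j\<^sub>1 \<noteq> j\<^sub>2"
  obtains R :: "bool \<Rightarrow> 's list" where "length (R True) = length (R False)" "R True \<noteq> R False"
    "\<And>c. successively E (s # R c @ [b])"
proof -
  obtain p where p: "successively E (s # p @ [i])" using tranclp_imp_path[OF conn(1)] by blast
  obtain p1 where p1: "successively E (j\<^sub>1 # p1 @ [i])" using tranclp_imp_path[OF conn(2)] by blast
  obtain p2 where p2: "successively E (j\<^sub>2 # p2 @ [i])" using tranclp_imp_path[OF conn(3)] by blast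
  obtain q where q: "successively E (i # q @ [b])" using tranclp_imp_path[OF conn(4)] by blast
  define R where "R c = p @ [i] @ (if c then (j\<^sub>1 # p1 @ [i]) @ (j\<^sub>2 # p2 @ [i])
      else (j\<^sub>2 # p2 @ [i]) @ (j\<^sub>1 # p1 @ [i])) @ q" for c
  show thesis
  proof
    \<comment> \<open>After the common prefix \<open>p @ [i]\<close> the two words continue with the
      distinct symbols \<open>j\<^sub>1\<close> and \<open>j\<^sub>2\<close>.\<close>
    show "length (R True) = length (R False)" "R True \<noteq> R False"
      using branch(3) by (simp_all add: R_def)
    have glue: "successively E (xs @ [x]) \<Longrightarrow> successively E ([x] @ ys) \<Longrightarrow>
        successively E (xs @ [x] @ ys)" for xs ys and x
      by (auto simp: successively_append_iff)
    have l1: "successively E ([i] @ j\<^sub>1 # p1 @ [i])" and l2: "successively E ([i] @ j\<^sub>2 # p2 @ [i])"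
      using p1 p2 branch by simp_all
    have q': "successively E ([i] @ q @ [b])" using q by simp
    have "successively E ([i] @ (j\<^sub>1 # p1 @ [i]) @ (j\<^sub>2 # p2 @ [i]) @ q @ [b])"
      using glue[of "i # j\<^sub>1 # p1" i "(j\<^sub>2 # p2 @ [i]) @ q @ [b]"]
        glue[of "i # j\<^sub>2 # p2" i "q @ [b]"] l1 l2 q' by simp
    moreover have "successively E ([i] @ (j\<^sub>2 # p2 @ [i]) @ (j\<^sub>1 # p1 @ [i]) @ q @ [b])"
      using glue[of "i # j\<^sub>2 # p2" i "(j\<^sub>1 # p1 @ [i]) @ q @ [b]"]
        glue[of "i # j\<^sub>1 # p1" i "q @ [b]"] l1 l2 q' by simp
    ultimately show "successively E (s # R c @ [b])" for c
      using glue[of "s # p" i] p by (cases c) (simp_all add: R_def)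
  qed
qed

text \<open>Entries of matrix powers count paths. Expanding the last factor, a positive sum over the
  penultimate vertex has a nonzero term, which gives a shorter path and a last edge.\<close>

lemma pow_mat_pos_imp_relpowp:
  fixes A :: "nat mat"
  assumes A: "A \<in> carrier_mat N N" and entries: "\<And>i j. i < N \<Longrightarrow> j < N \<Longrightarrow> A $$ (i, j) \<in> {0, 1}"
    and "i < N" "j < N" "(A ^\<^sub>m k) $$ (i, j) > 0"
  shows "((\<lambda>i j. i < N \<and> j < N \<and> A $$ (i, j) = 1) ^^ k) i j"
  using assms(4,5)
proof (induction k arbitrary: j)
  case 0
  then show ?case using A \<open>i < N\<close> by (auto split: if_splits)
next
  case (Suc k)
  have "(A ^\<^sub>m Suc k) $$ (i, j) = (\<Sum>l<N. (A ^\<^sub>m k) $$ (i, l) * A $$ (l, j))"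
    using A \<open>i < N\<close> Suc.prems(1) by (simp add: scalar_prod_def lessThan_atLeast0)
  with Suc.prems(2) have "(\<Sum>l<N. (A ^\<^sub>m k) $$ (i, l) * A $$ (l, j)) \<noteq> 0"
    by (metis less_irrefl)
  then obtain l where l: "l < N" "(A ^\<^sub>m k) $$ (i, l) \<noteq> 0" "A $$ (l, j) \<noteq> 0"
    by (rule sum.not_neutral_contains_not_neutral) (simp add: that)
  then have "A $$ (l, j) = 1"
    using entries[of l j] Suc.prems(1) by simp
  with Suc l show ?case by auto
qed

lemma irreducible_matrix_tranclp:
  assumes "transition_matrix N A" "irreducible_matrix N A" "i < N" "j < N"
  shows "(\<lambda>i j. i < N \<and> j < N \<and> A $$ (i, j) = 1)\<^sup>+\<^sup>+ i j"
proof -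
  obtain k where "k > 0" "(A ^\<^sub>m k) $$ (i, j) > 0"
    using assms by (auto simp: irreducible_matrix_def)
  then show ?thesis
    using pow_mat_pos_imp_relpowp[of A N i j k] assms
    unfolding transition_matrix_def tranclp_power by blast
qed

text \<open>A row of zeros and ones sums to its number of ones.\<close>

lemma ex_branching_symbols:
  fixes A :: "nat mat"
  assumes "\<And>j. j < N \<Longrightarrow> A $$ (i, j) \<in> {0, 1}" and "(\<Sum>j<N. A $$ (i, j)) \<ge> 2"
  obtains j\<^sub>1 j\<^sub>2 where "j\<^sub>1 < N" "j\<^sub>2 < N" "j\<^sub>1 \<noteq> j\<^sub>2" "A $$ (i, j\<^sub>1) = 1" "A $$ (i, j\<^sub>2) = 1"
proof -
  let ?J = "{j. j < N \<and> A $$ (i, j) = 1}"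
  have "(\<Sum>j<N. A $$ (i, j)) = (\<Sum>j\<in>?J. A $$ (i, j))"
    using assms(1) by (intro sum.mono_neutral_right) fastforce+
  also have "\<dots> = card ?J" by simp
  finally have "card ?J \<ge> 2" using assms(2) by simp
  then obtain j\<^sub>1 j\<^sub>2 where "j\<^sub>1 \<in> ?J" "j\<^sub>2 \<in> ?J" "j\<^sub>1 \<noteq> j\<^sub>2"
    by (metis (no_types, lifting) card_le_Suc0_iff_eq card.infinite not_less_eq_eq
        numeral_2_eq_2 le0)
  then show thesis using that by blast
qed

section \<open>Scrambled sets\<close>

lemma uncountable_bool_sequences: "uncountable (UNIV :: (nat \<Rightarrow> bool) set)"
proof
  assume "countable (UNIV :: (nat \<Rightarrow> bool) set)"
  then have "range (from_nat_into (UNIV :: (nat \<Rightarrow> bool) set)) = UNIV"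
    by (intro range_from_nat_into) auto
  \<comment> \<open>Cantor's argument: the negated diagonal would be the \<open>n\<close>-th listed
    sequence, yet it differs from that sequence at \<open>n\<close>.\<close>
  then obtain n where "from_nat_into UNIV n = (\<lambda>n. \<not> from_nat_into UNIV n n)"
    by (metis (mono_tags) UNIV_I imageE)
  then show False by metis
qed

lemma liminf_eq_0_if_subseq:
  fixes u :: "nat \<Rightarrow> real"
  assumes "\<And>n. 0 \<le> u n" and "strict_mono r" and "(\<lambda>n. u (r n)) \<longlonglongrightarrow> 0"
  shows "liminf (\<lambda>n. ereal (u n)) = 0"
proof (rule antisym)
  have "liminf ((\<lambda>n. ereal (u n)) \<circ> r) = 0"
    using assms(3) by (intro lim_imp_Liminf) (auto simp: o_def zero_ereal_def)
  then show "liminf (\<lambda>n. ereal (u n)) \<le> 0"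
    using liminf_subseq_mono[OF assms(2), of "\<lambda>n. ereal (u n)"] by simp
  show "0 \<le> liminf (\<lambda>n. ereal (u n))"
    using assms(1) by (intro Liminf_bounded) auto
qed

lemma limsup_ge_if_INFM:
  fixes u :: "nat \<Rightarrow> 'b::complete_linorder"
  assumes "\<exists>\<^sub>\<infinity>n. c \<le> u n"
  shows "c \<le> limsup u"
proof (rule ccontr)
  assume "\<not> c \<le> limsup u"
  then have "\<forall>\<^sub>F n in sequentially. u n < c"
    by (intro Limsup_lessD) auto
  with assms show False
    by (auto simp: frequently_def cofinite_eq_sequentially not_le)
qed

theorem theorem3p2:
  fixes f :: "nat \<Rightarrow> 'a::metric_space \<Rightarrow> 'a"
    and k :: "nat \<Rightarrow> nat"
    and N :: nat
    and A :: "nat mat"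
    and V :: "nat \<Rightarrow> 'a set"
    and W :: "nat \<Rightarrow> nat \<Rightarrow> 'a set"
  assumes "strict_mono_on {1..} k" and "\<forall>n\<ge>1. k n > 0"
    and "N \<ge> 2"
    and "transition_matrix N A" and "irreducible_matrix N A"
    and "\<exists>i\<^sub>0<N. (\<Sum>j<N. A $$ (i\<^sub>0, j)) \<ge> 2"
    and "disjoint_family_on V {..<N}"
    and "\<forall>i<N. V i \<noteq> {} \<and> compact (V i)"
    and "\<forall>n. continuous_on (\<Union>i<N. V i) (induced f k n)"
    and "\<forall>i<N. \<forall>n. W i n \<noteq> {} \<and> closed (W i n) \<and> W i n \<subseteq> V i"
    and "\<forall>\<alpha>\<in>subshift N A. \<forall>m n. itinerary_set (induced f k) W \<alpha> m n \<noteq> {}"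
    and "\<exists>\<beta>\<in>subshift N A. \<exists>m :: nat \<Rightarrow> nat. \<exists>s\<^sub>0<N.
           strict_mono_on {1..} m \<and> (\<forall>l\<ge>1. m l > 0) \<and> (\<forall>l\<ge>1. \<beta> (m l) = s\<^sub>0) \<and>
           (\<forall>n :: nat \<Rightarrow> nat. strict_mono_on {1..} n \<longrightarrow>
              (\<lambda>l. diameter (itinerary_set (induced f k) W \<beta> (m l) (n l)))
                \<longlonglongrightarrow> 0)"
  shows "(\<exists>\<delta>>0. li_yorke_chaotic f \<delta>) \<and>
         (bounded (UNIV :: 'a set) \<longrightarrow> strongly_li_yorke_chaotic f)"
proof -
  let ?g = "induced f k"
  let ?U = "\<Union>i<N. V i"
  let ?E = "\<lambda>i j. i < N \<and> j < N \<and> A $$ (i, j) = 1"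
  have entries: "A $$ (i, j) \<in> {0, 1}" if "i < N" "j < N" for i j
    using assms(4) that by (auto simp: transition_matrix_def)
  obtain \<beta> m s\<^sub>0 where \<beta>: "\<beta> \<in> subshift N A" and "s\<^sub>0 < N"
    and m: "\<And>l. l \<ge> 1 \<Longrightarrow> \<beta> (m l) = s\<^sub>0"
    and diam: "\<And>n :: nat \<Rightarrow> nat. strict_mono_on {1..} n \<Longrightarrow>
        (\<lambda>l. diameter (itinerary_set ?g W \<beta> (m l) (n l))) \<longlonglongrightarrow> 0"
    using assms(12) by blast
  obtain i\<^sub>0 where i0: "i\<^sub>0 < N" "(\<Sum>j<N. A $$ (i\<^sub>0, j)) \<ge> 2" using assms(6) by blast
  obtain j\<^sub>1 j\<^sub>2 where j: "j\<^sub>1 < N" "j\<^sub>2 < N" "j\<^sub>1 \<noteq> j\<^sub>2" "A $$ (i\<^sub>0, j\<^sub>1) = 1" "A $$ (i\<^sub>0, j\<^sub>2) = 1"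
    using ex_branching_symbols[of N A i\<^sub>0] entries i0 by blast
  have conn: "?E\<^sup>+\<^sup>+ i j" if "i < N" "j < N" for i j
    using irreducible_matrix_tranclp assms(4,5) that by blast
  have \<beta>E: "?E (\<beta> n) (\<beta> (Suc n))" for n
    using \<beta> by (auto simp: subshift_def)
  obtain R where R: "length (R True) = length (R False)" "R True \<noteq> R False"
    "\<And>c. successively ?E (s\<^sub>0 # R c @ [\<beta> 0])"
    using ex_distinct_paths_equal_length[of ?E s\<^sub>0 i\<^sub>0 j\<^sub>1 j\<^sub>2 "\<beta> 0"] conn j i0 \<open>s\<^sub>0 < N\<close> \<beta>E
    by blast
  \<comment> \<open>The hypothesis controls \<open>m l\<close> only for \<open>l\<close> at least 1,
    so block \<open>l\<close> uses \<open>m (Suc l)\<close>.\<close>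
  obtain \<alpha> :: "(nat \<Rightarrow> bool) \<Rightarrow> nat \<Rightarrow> nat" and t :: "nat \<Rightarrow> nat"
    where t: "strict_mono t" and \<alpha>E: "\<And>d n. ?E (\<alpha> d n) (\<alpha> d (Suc n))"
      and agree: "\<And>d l i. i \<le> m (Suc l) \<Longrightarrow> \<alpha> d (t l + i) = \<beta> i"
      and differ: "\<And>d d'. d \<noteq> d' \<Longrightarrow> \<exists>\<^sub>\<infinity>n. \<alpha> d n \<noteq> \<alpha> d' n"
    by (rule ex_uncountable_coding[of ?E \<beta> "\<lambda>l. m (Suc l)" s\<^sub>0 R, OF \<beta>E m R]) auto
  have \<alpha>N: "\<alpha> d n < N" for d n using \<alpha>E by blast
  have W: "compact (W i n)" "W i n \<subseteq> V i" "W i n \<subseteq> ?U" if "i < N" for i n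
  proof -
    show "W i n \<subseteq> V i" using assms(10) that by blast
    then show "W i n \<subseteq> ?U" using that by blast
    have "W i n = V i \<inter> W i n" using \<open>W i n \<subseteq> V i\<close> by blast
    then show "compact (W i n)" using assms(8,10) that compact_Int_closed by metis
  qed
  have "\<exists>x. \<forall>j. ncomp ?g 0 j x \<in> W (\<alpha> d j) j" for d
  proof (rule ex_infinite_itinerary[of ?U])
    show "continuous_on ?U (?g n)" for n using assms(9) by blast
    show "compact (W (\<alpha> d j) n)" "W (\<alpha> d j) n \<subseteq> ?U" for j n
      by (rule W[OF \<alpha>N])+
    have "\<alpha> d \<in> subshift N A" using \<alpha>E by (auto simp: subshift_def)
    then show "itinerary_set ?g W (\<alpha> d) m 0 \<noteq> {}" for m
      using assms(11) by blast
  qed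
  then obtain x where x: "\<And>d j. ncomp ?g 0 j (x d) \<in> W (\<alpha> d j) j" by metis
  obtain \<epsilon> where \<epsilon>: "\<epsilon> > 0"
    "\<And>i j x y. \<lbrakk>i < N; j < N; i \<noteq> j; x \<in> V i; y \<in> V j\<rbrakk> \<Longrightarrow> \<epsilon> \<le> dist x y"
    using finite_disjoint_compact_separated[of "{..<N}" V] assms(7,8) by auto
  \<comment> \<open>Time \<open>n\<close> of the induced system is time \<open>r n\<close> of
    \<open>f\<close>. Time 0 replaces the arbitrary \<open>k 0\<close>; positivity of
    \<open>k 1\<close> then makes \<open>r\<close> strictly increasing.\<close>
  define r where "r n = (if n = 0 then 0 else k n)" for n
  have gr: "ncomp ?g 0 n = ncomp f 0 (r n)" for n
    using ncomp_induced[OF assms(1), of f "n - 1"] by (cases n) (auto simp: r_def)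
  have r: "strict_mono r"
    using assms(1,2) by (auto simp: strict_mono_Suc_iff r_def strict_mono_on_def)

  have liminf: "liminf (\<lambda>n. ereal (dist (ncomp f 0 n (x d)) (ncomp f 0 n (x d')))) = 0" for d d'
  proof (rule liminf_eq_0_if_subseq)
    \<comment> \<open>From induced time \<open>t l\<close> on, every coded itinerary runs through
      \<open>\<beta>\<close> up to index \<open>m (Suc l)\<close>, so both points lie in the same
      set \<open>?I l\<close> at that time.\<close>
    let ?I = "\<lambda>l. itinerary_set ?g W \<beta> (m (Suc l)) (t l)"
    have mem: "ncomp ?g 0 (t l) (x d) \<in> ?I l" for l d
      unfolding mem_itinerary_set_iff
    proof (intro allI impI)
      fix j assume "j \<le> m (Suc l)"
      with x[of "t l + j" d] agree
      show "ncomp ?g (t l) j (ncomp ?g 0 (t l) (x d)) \<in> W (\<beta> j) (t l + j)"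
        using ncomp_shift[of ?g 0 "t l" j "x d"] by simp
    qed
    \<comment> \<open>Only for a bounded set does \<open>diameter\<close> bound the
      distances.\<close>
    have "bounded (?I l)" for l
    proof (rule bounded_subset)
      show "?I l \<subseteq> V (\<beta> 0)"
        using W(2)[of "\<beta> 0"] \<beta>E[of 0] by (fastforce simp: mem_itinerary_set_iff)
      show "bounded (V (\<beta> 0))"
        using assms(8) \<beta>E[of 0] by (auto intro: compact_imp_bounded)
    qed
    then have le: "dist (ncomp f 0 (r (t l)) (x d)) (ncomp f 0 (r (t l)) (x d')) \<le> diameter (?I l)" for l
      using mem by (auto simp: gr[symmetric] intro: diameter_bounded_bound)
    \<comment> \<open>The hypothesis pairs \<open>m l\<close> with \<open>n l\<close>. Taking
      \<open>n l = t (l - 1)\<close> pairs \<open>m (Suc l)\<close> with \<open>t l\<close> after a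
      shift of the limit by one.\<close>
    have "strict_mono_on {1..} (\<lambda>l. t (l - 1))"
      using t by (auto simp: strict_mono_on_def strict_mono_def)
    then have "(\<lambda>l. diameter (?I l)) \<longlonglongrightarrow> 0"
      using LIMSEQ_Suc[OF diam] by force
    then show "(\<lambda>l. dist (ncomp f 0 ((r \<circ> t) l) (x d)) (ncomp f 0 ((r \<circ> t) l) (x d'))) \<longlonglongrightarrow> 0"
      by (rule tendsto_0_le[where K = 1]) (simp add: order_trans[OF le abs_ge_self])
    show "strict_mono (r \<circ> t)" using r t by (rule strict_mono_o)
  qed simp

  have limsup: "limsup (\<lambda>n. ereal (dist (ncomp f 0 n (x d)) (ncomp f 0 n (x d')))) > ereal (\<epsilon> / 2)"
    (is "limsup ?u > _") if "d \<noteq> d'" for d d'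
  proof -
    have "ncomp f 0 (r n) (x d) \<in> V (\<alpha> d n)" for d n
      using x[of n d] W(2)[OF \<alpha>N] unfolding gr by blast
    then have "ereal \<epsilon> \<le> (?u \<circ> r) n" if "\<alpha> d n \<noteq> \<alpha> d' n" for n
      using \<epsilon>(2)[OF \<alpha>N \<alpha>N that] by simp
    then have inf: "\<exists>\<^sub>\<infinity>n. ereal \<epsilon> \<le> (?u \<circ> r) n"
      by (intro INFM_mono[OF differ[OF that]])
    \<comment> \<open>Infinitely many distances of at least \<open>\<epsilon>\<close> give an upper
      limit of at least \<open>\<epsilon>\<close>; halving makes the inequality strict.\<close>
    have "ereal (\<epsilon> / 2) < ereal \<epsilon>" using \<epsilon>(1) by simp
    also have "\<dots> \<le> limsup (?u \<circ> r)" using inf by (rule limsup_ge_if_INFM)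
    also have "\<dots> \<le> limsup ?u" using r by (rule limsup_subseq_mono)
    finally show ?thesis .
  qed

  \<comment> \<open>Equal points would have upper limit 0, so distinct codes give distinct points
    and the uncountability of the codes passes to \<open>range x\<close>.\<close>
  have "inj x"
  proof (rule injI, rule ccontr)
    fix d d' assume "x d = x d'" "d \<noteq> d'"
    with limsup[of d d'] \<epsilon>(1) show False
      by (simp add: Limsup_const zero_ereal_def[symmetric])
  qed
  then have unc: "uncountable (range x)"
    using uncountable_bool_sequences by (auto dest: countable_image_inj_on)
  have scr: "scrambled_set f (\<epsilon> / 2) (range x)"
    unfolding scrambled_set_def by (auto intro!: liminf limsup)
  have "\<epsilon> / 2 > 0" using \<epsilon>(1) by simp
  with unc scr have "li_yorke_chaotic f (\<epsilon> / 2)"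
    unfolding li_yorke_chaotic_def by blast
  moreover have "strongly_li_yorke_chaotic f" if "bounded (UNIV :: 'a set)"
    unfolding strongly_li_yorke_chaotic_def
    using unc scr \<open>\<epsilon> / 2 > 0\<close> bounded_subset[OF that subset_UNIV] by blast
  ultimately show ?thesis
    using \<open>\<epsilon> / 2 > 0\<close> by blast
qed

end
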